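(* Let $n\ge1$, let $v=(v_1,\dots,v_n)$ with $v_i\in\mathbb{R}\setminus\{0\}$ for all $i$, let $B_1,\dots,B_n$ be i.i.d. Bernoulli random variables of parameter $p\in[0,1]$, and let $S_v=v_1B_1+\cdots+v_nB_n$. Then $$Q(S_v,0)\ \leq\ \frac{1}{\sqrt{1+2np(1-p)}}.$$
   Context: For a discrete real-valued random variable $S$, $Q(S,0)=\max_{x\in\mathbb{R}}\mathbb{P}(S=x)$. A Bernoulli random variable $B$ of parameter $p$ takes values in $\{0,1\}$ with $\mathbb{P}(B=1)=p=1-\mathbb{P}(B=0)$. *)

theory Defs
  imports "HOL-Probability.Probability"
begin

definition is_bernoulli :: "'a measure \<Rightarrow> ('a \<Rightarrow> real) \<Rightarrow> real \<Rightarrow> bool" where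
  "is_bernoulli M X p \<longleftrightarrow>
     X \<in> borel_measurable M \<and> (AE \<omega> in M. X \<omega> \<in> {0, 1}) \<and>
     measure M {\<omega> \<in> space M. X \<omega> = 1} = p \<and>
     measure M {\<omega> \<in> space M. X \<omega> = 0} = 1 - p"

text \<open>
  The quantity \<open>Q(S, 0)\<close>. It is written as a supremum because \<open>Max\<close> requires a finite set;
  the lemma \<open>Q0_is_max\<close> below shows that the supremum is a maximum.
\<close>

definition Q0 :: "'a measure \<Rightarrow> ('a \<Rightarrow> real) \<Rightarrow> real" where
  "Q0 M S = (SUP x. measure M {\<omega> \<in> space M. S \<omega> = x})"

lemma Q0_is_max:
  assumes "prob_space M" and S[measurable]: "S \<in> borel_measurable M"
  shows "\<exists>x. Q0 M S = measure M {\<omega> \<in> space M. S \<omega> = x}"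
    and "measure M {\<omega> \<in> space M. S \<omega> = y} \<le> Q0 M S"
proof -
  interpret prob_space M by fact
  define f where "f x = measure M {\<omega> \<in> space M. S \<omega> = x}" for x
  have bdd: "bdd_above (range f)"
    unfolding f_def by (rule bdd_aboveI[where M = 1]) auto
  have Q: "Q0 M S = Sup (range f)" by (simp add: Q0_def f_def[abs_def])
  have le: "f x \<le> Q0 M S" for x
    unfolding Q by (rule cSup_upper[OF _ bdd]) auto
  show "measure M {\<omega> \<in> space M. S \<omega> = y} \<le> Q0 M S"
    using le[of y] by (simp add: f_def)
  have "\<exists>x. Q0 M S = f x"
  proof (cases "Q0 M S > 0")
    case False
    have "f 0 \<ge> 0" by (simp add: f_def)
    with False le[of 0] show ?thesis by (intro exI[of _ 0]) auto
  next
    case True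
    define s where "s = Q0 M S"
    define A where "A = {x. f x > s / 2}"
    have s: "s > 0" using True by (simp add: s_def)
    have bound: "real (card F) * (s / 2) \<le> 1" if F: "finite F" "F \<subseteq> A" for F
    proof -
      have "real (card F) * (s / 2) = (\<Sum>x\<in>F. s / 2)" by simp
      also have "\<dots> \<le> (\<Sum>x\<in>F. f x)"
        using F by (intro sum_mono) (auto simp: A_def intro: less_imp_le)
      also have "\<dots> = measure M (\<Union>x\<in>F. {\<omega> \<in> space M. S \<omega> = x})"
        unfolding f_def using F
        by (intro finite_measure_finite_Union[symmetric])
           (auto simp: disjoint_family_on_def)
      also have "\<dots> \<le> 1" by simp
      finally show ?thesis .
    qed
    have fin: "finite A"
    proof (rule ccontr)
      assume "infinite A"
      obtain k :: nat where k: "real k > 2 / s" using reals_Archimedean2 by blast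
      obtain F where F: "finite F" "card F = k" "F \<subseteq> A"
        using infinite_arbitrarily_large[OF \<open>infinite A\<close>] by blast
      have "real k * (s / 2) \<le> 1" using bound[of F] F by simp
      with k s show False by (simp add: field_simps)
    qed
    have "s / 2 < Sup (range f)" using s by (simp add: s_def Q)
    then obtain x0 where x0: "x0 \<in> A"
      using less_cSupE[of "s / 2" "range f"] by (auto simp: A_def)
    obtain m where m: "m \<in> A" "\<And>x. x \<in> A \<Longrightarrow> f x \<le> f m"
    proof -
      have "Max (f ` A) \<in> f ` A" using fin x0 by (intro Max_in) auto
      then obtain m where "m \<in> A" "f m = Max (f ` A)" by auto
      moreover have "f x \<le> Max (f ` A)" if "x \<in> A" for x using fin that by auto
      ultimately show ?thesis using that by auto
    qed
    have "f x \<le> f m" for x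
      using m by (cases "x \<in> A") (auto simp: A_def)
    then have "Q0 M S \<le> f m" unfolding Q by (intro cSup_least) auto
    with le[of m] show ?thesis by (intro exI[of _ m]) auto
  qed
  then show "\<exists>x. Q0 M S = measure M {\<omega> \<in> space M. S \<omega> = x}" by (simp add: f_def)
qed

end

theory Submission
  imports Defs
begin

text \<open>
  An atom of \<open>S\<close> is at most the asymptotic mean over \<open>t\<close> of the modulus of the characteristic
  function of \<open>S\<close>. Each factor of this modulus is at most \<open>exp (- 2 p (1 - p) sin\<^sup>2 (v\<^sub>i t / 2))\<close>;
  by convexity of \<open>exp\<close> the product is at most the average over \<open>i\<close> of
  \<open>exp (- 2 n p (1 - p) sin\<^sup>2 (v\<^sub>i t / 2)) \<le> 1 / (1 + 2 n p (1 - p) sin\<^sup>2 (v\<^sub>i t / 2))\<close>.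
  The mean of \<open>1 / (1 + a sin\<^sup>2 \<theta>)\<close> over a period is exactly \<open>1 / sqrt (1 + a)\<close>, and the frequency
  \<open>v\<^sub>i \<noteq> 0\<close> does not change it.
\<close>

section \<open>Atoms and the mean modulus of the characteristic function\<close>

text \<open>The average of cos (t (\<open>X\<close> - \<open>x\<close>)) over 0 \<le> t \<le> T
  tends to the indicator of \<open>X\<close> = \<open>x\<close> as T grows, and by Fubini its
  expectation is at most the average of \<open>g\<close>. The mean of \<open>g\<close> enters
  through the linear growth of a primitive \<open>G\<close>, so no limit of averages of
  \<open>g\<close> has to be shown to exist.\<close>

lemma (in prob_space) prob_eq_le_char_mean:
  fixes X :: "'a \<Rightarrow> real" and g G :: "real \<Rightarrow> real"
  assumes X[measurable]: "X \<in> borel_measurable M"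
    and G: "\<And>t. (G has_real_derivative g t) (at t)"
    and g: "\<And>t. isCont g t"
    and char_le: "\<And>t. cmod (char (distr M borel X) t) \<le> g t"
    and G_le: "\<And>T. T \<ge> 0 \<Longrightarrow> G T - G 0 \<le> c * T + C"
  shows "prob {\<omega> \<in> space M. X \<omega> = x} \<le> c"
proof -
  interpret P: pair_sigma_finite M lborel ..
  \<comment> \<open>This is the time average of the cosine over [0, \<open>Suc N\<close>]. The
    successor keeps the length positive, and \<open>sinc\<close> at 0 is 1, the value wanted on the
    atom.\<close>
  define f where "f N \<omega> = sinc (real (Suc N) * (X \<omega> - x))" for N \<omega>
  define h where "h T \<omega> t = cos (t * (X \<omega> - x)) * indicator {0..T} t" for T \<omega> t
  have abs_sinc: "\<bar>sinc y\<bar> \<le> 1" for y :: real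
    using abs_sin_x_le_abs_x[of y] by (auto simp: divide_simps)
  have mf[measurable]: "f N \<in> borel_measurable M" for N
    unfolding f_def by measurable
  have "(\<lambda>N. expectation (f N)) \<longlonglongrightarrow> expectation (indicator {\<omega> \<in> space M. X \<omega> = x})"
  proof (rule integral_dominated_convergence[where w = "\<lambda>_. 1"])
    show "AE \<omega> in M. (\<lambda>N. f N \<omega>) \<longlonglongrightarrow> indicator {\<omega> \<in> space M. X \<omega> = x} \<omega>"
    proof (rule AE_I2)
      fix \<omega> assume \<omega>: "\<omega> \<in> space M"
      show "(\<lambda>N. f N \<omega>) \<longlonglongrightarrow> indicator {\<omega> \<in> space M. X \<omega> = x} \<omega>"
      proof (cases "X \<omega> = x")
        case True
        then show ?thesis using \<omega> by (simp add: f_def)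
      next
        case False
        have "(\<lambda>N. f N \<omega>) \<longlonglongrightarrow> 0"
        proof (rule Lim_null_comparison)
          show "\<forall>\<^sub>F N in sequentially. norm (f N \<omega>) \<le> inverse \<bar>X \<omega> - x\<bar> * inverse (real (Suc N))"
            using False by (intro always_eventually)
              (auto simp: f_def abs_mult divide_simps simp del: of_nat_Suc)
          show "(\<lambda>N. inverse \<bar>X \<omega> - x\<bar> * inverse (real (Suc N))) \<longlonglongrightarrow> 0"
            by (rule tendsto_mult_right_zero[OF LIMSEQ_inverse_real_of_nat])
        qed
        then show ?thesis using False by simp
      qed
    qed
    show "AE \<omega> in M. norm (f N \<omega>) \<le> 1" for N
      unfolding f_def real_norm_def by (intro AE_I2 abs_sinc)
  qed simp_all
  then have lim: "(\<lambda>N. expectation (f N)) \<longlonglongrightarrow> prob {\<omega> \<in> space M. X \<omega> = x}"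
    by simp
  have mean: "expectation (f N) \<le> c + C * inverse (real (Suc N))" for N
  proof -
    define T where "T = real (Suc N)"
    have T: "T > 0" by (simp add: T_def)
    have inner: "(\<integral>t. h T \<omega> t \<partial>lborel) = T * f N \<omega>" for \<omega>
    proof (cases "X \<omega> = x")
      case True
      then show ?thesis using T by (simp add: h_def f_def)
    next
      case False
      have "(\<integral>t. h T \<omega> t \<partial>lborel) = sin (T * (X \<omega> - x)) / (X \<omega> - x) - sin (0 * (X \<omega> - x)) / (X \<omega> - x)"
        unfolding h_def
        by (rule integral_FTC_Icc_real)
          (use T False in \<open>auto intro!: derivative_eq_intros continuous_intros\<close>)
      then show ?thesis using False T by (simp add: f_def T_def[symmetric] del: of_nat_Suc)
    qed
    have int: "integrable (M \<Otimes>\<^sub>M lborel) (\<lambda>(\<omega>, t). h T \<omega> t)"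
    proof (rule integrableI_bounded_set[where A = "space M \<times> {0..T}" and B = 1])
      show "emeasure (M \<Otimes>\<^sub>M lborel) (space M \<times> {0..T}) < \<infinity>"
        using T by (simp add: lborel.emeasure_pair_measure_Times emeasure_space_1)
    qed (auto intro!: AE_I2 simp: h_def space_pair_measure indicator_def split: if_splits)
    \<comment> \<open>The cosine is the real part of a complex exponential. Centering at
      \<open>x\<close> only multiplies the characteristic function by a number of modulus 1.\<close>
    have outer: "(\<integral>\<omega>. h T \<omega> t \<partial>M) \<le> g t * indicator {0..T} t" for t
    proof -
      have ic: "integrable M (\<lambda>\<omega>. iexp (t * (X \<omega> - x)))"
        by (rule integrable_const_bound[where B = 1]) auto
      have "(\<integral>\<omega>. cos (t * (X \<omega> - x)) \<partial>M) = (\<integral>\<omega>. Re (iexp (t * (X \<omega> - x))) \<partial>M)"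
        by (simp add: Re_exp del: of_real_mult of_real_diff)
      also have "\<dots> = Re (CLINT \<omega>|M. iexp (t * (X \<omega> - x)))"
        by (rule integral_Re[OF ic])
      also have "\<dots> \<le> cmod (CLINT \<omega>|M. iexp (t * (X \<omega> - x)))"
        by (rule complex_Re_le_cmod)
      also have "(CLINT \<omega>|M. iexp (t * (X \<omega> - x))) = (CLINT \<omega>|M. iexp (- (t * x)) * iexp (t * X \<omega>))"
        by (intro Bochner_Integration.integral_cong) (auto simp: exp_add[symmetric] algebra_simps)
      also have "\<dots> = iexp (- (t * x)) * char (distr M borel X) t"
        by (simp add: char_def integral_distr)
      also have "cmod \<dots> = cmod (char (distr M borel X) t)"
        unfolding norm_mult norm_exp_i_times by simp
      finally have "(\<integral>\<omega>. cos (t * (X \<omega> - x)) \<partial>M) \<le> g t" using char_le[of t] by simp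
      then show ?thesis
        by (auto simp: h_def split: split_indicator)
    qed
    have gint: "has_bochner_integral lborel (\<lambda>t. g t * indicator {0..T} t) (G T - G 0)"
      by (rule has_bochner_integral_FTC_Icc_real) (use T G g in auto)
    have "T * expectation (f N) = (\<integral>\<omega>. (\<integral>t. h T \<omega> t \<partial>lborel) \<partial>M)"
      by (simp add: inner)
    also have "\<dots> = (\<integral>t. (\<integral>\<omega>. h T \<omega> t \<partial>M) \<partial>lborel)"
      using P.Fubini_integral[OF int] by simp
    also have "\<dots> \<le> (\<integral>t. g t * indicator {0..T} t \<partial>lborel)"
      by (rule integral_mono)
        (use P.integrable_snd[OF int] gint outer in \<open>auto simp: has_bochner_integral_iff\<close>)
    also have "\<dots> \<le> c * T + C"
      using gint G_le[of T] T by (simp add: has_bochner_integral_iff)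
    finally have "expectation (f N) \<le> (c * T + C) / T"
      using T by (simp add: field_simps)
    then show ?thesis using T by (simp add: T_def[symmetric] field_simps del: of_nat_Suc)
  qed
  \<comment> \<open>The bounded error \<open>C\<close> is divided by the length of the interval and
    vanishes in the limit.\<close>
  have "(\<lambda>N. c + C * inverse (real (Suc N))) \<longlonglongrightarrow> c + C * 0"
    by (intro tendsto_intros LIMSEQ_inverse_real_of_nat)
  then show ?thesis
    using LIMSEQ_le[OF lim] mean by auto
qed

section \<open>The mean of the reciprocal of 1 + (c^2 - 1) sin^2\<close>

text \<open>
  The usual primitive \<open>arctan (c tan \<theta>) / c\<close> of \<open>1 / (1 + (c\<^sup>2 - 1) sin\<^sup>2 \<theta>)\<close>, with
  \<open>\<theta>\<close> split off from the arctangent so that it is smooth across the poles of \<open>tan\<close>.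
\<close>

definition primitive_inverse_sin2 :: "real \<Rightarrow> real \<Rightarrow> real" where
  "primitive_inverse_sin2 c \<theta> =
    (\<theta> + arctan ((c - 1) * (sin \<theta> * cos \<theta>) / ((cos \<theta>)\<^sup>2 + c * (sin \<theta>)\<^sup>2))) / c"

lemma primitive_inverse_sin2_0 [simp]: "primitive_inverse_sin2 c 0 = 0"
  by (simp add: primitive_inverse_sin2_def)

text \<open>The arctangent is only a bounded correction, so the primitive grows linearly with slope
  1/\<open>c\<close>. This slope is the mean of its derivative.\<close>

lemma primitive_inverse_sin2_bound:
  assumes "c > 0"
  shows "\<bar>primitive_inverse_sin2 c \<theta> - \<theta> / c\<bar> \<le> pi / (2 * c)"
proof -
  define y where "y = (c - 1) * (sin \<theta> * cos \<theta>) / ((cos \<theta>)\<^sup>2 + c * (sin \<theta>)\<^sup>2)"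
  have "\<bar>primitive_inverse_sin2 c \<theta> - \<theta> / c\<bar> = \<bar>arctan y\<bar> / c"
    using assms by (simp add: primitive_inverse_sin2_def y_def[symmetric] add_divide_distrib)
  also have "\<dots> \<le> (pi / 2) / c"
    using arctan_bounded[of y] assms by (intro divide_right_mono) auto
  finally show ?thesis by simp
qed

lemma has_real_derivative_primitive_inverse_sin2:
  assumes c: "c > 0"
  shows "(primitive_inverse_sin2 c has_real_derivative 1 / (1 + (c\<^sup>2 - 1) * (sin \<theta>)\<^sup>2)) (at \<theta>)"
proof -
  define s k where "s = sin \<theta>" and "k = cos \<theta>"
  \<comment> \<open>Rotating the vector (\<open>k\<close>, \<open>c * s\<close>) by
    -\<open>\<theta>\<close> gives (\<open>D\<close>, \<open>(c - 1) * (s * k)\<close>), and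
    \<open>E\<close> is its squared length. This is the identity \<open>DE\<close>; \<open>D\<close>
    > 0 keeps the quotient inside the arctangent smooth.\<close>
  define D where "D = k\<^sup>2 + c * s\<^sup>2"
  define E where "E = k\<^sup>2 + c\<^sup>2 * s\<^sup>2"
  have sk: "s\<^sup>2 + k\<^sup>2 = 1" by (simp add: s_def k_def)
  have Dpos: "D > 0"
  proof (cases "s = 0")
    case True then show ?thesis using sk by (simp add: D_def)
  next
    case False then show ?thesis using c by (simp add: D_def add_nonneg_pos)
  qed
  have Epos: "E > 0"
  proof (cases "s = 0")
    case True then show ?thesis using sk by (simp add: E_def)
  next
    case False then show ?thesis using c by (simp add: E_def add_nonneg_pos)
  qed
  have DE: "D\<^sup>2 + ((c - 1) * (s * k))\<^sup>2 = E"
  proof -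
    have "D\<^sup>2 + ((c - 1) * (s * k))\<^sup>2 = (s\<^sup>2 + k\<^sup>2) * E"
      by (simp add: D_def E_def power2_eq_square algebra_simps)
    then show ?thesis by (simp add: sk)
  qed
  \<comment> \<open>The numerator from the quotient rule reduces to \<open>c - E\<close>. The
    arctangent therefore has derivative \<open>c / E - 1\<close>; the summand
    \<open>\<theta>\<close> cancels the -1, and division by \<open>c\<close> leaves
    \<open>1 / E\<close>.\<close>
  have num: "(c - 1) * (k\<^sup>2 - s\<^sup>2) * D - (c - 1) * (s * k) * (2 * (c - 1) * s * k)
      = c * (s\<^sup>2 + k\<^sup>2)\<^sup>2 - (s\<^sup>2 + k\<^sup>2) * E"
    by (simp add: D_def E_def power2_eq_square algebra_simps)
  let ?N = "(c - 1) * (k\<^sup>2 - s\<^sup>2) * D - (c - 1) * (s * k) * (2 * (c - 1) * s * k)"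
  have "((\<lambda>x. (c - 1) * (sin x * cos x)) has_real_derivative (c - 1) * (k\<^sup>2 - s\<^sup>2)) (at \<theta>)"
    unfolding s_def k_def
    by (auto intro!: derivative_eq_intros simp: power2_eq_square)
  moreover have "((\<lambda>x. (cos x)\<^sup>2 + c * (sin x)\<^sup>2) has_real_derivative 2 * (c - 1) * s * k) (at \<theta>)"
    unfolding s_def k_def
    by (auto intro!: derivative_eq_intros simp: algebra_simps)
  moreover have "(cos \<theta>)\<^sup>2 + c * (sin \<theta>)\<^sup>2 \<noteq> 0"
    using Dpos by (simp add: D_def s_def k_def)
  ultimately have "((\<lambda>x. (c - 1) * (sin x * cos x) / ((cos x)\<^sup>2 + c * (sin x)\<^sup>2))
      has_real_derivative ?N / (D * D)) (at \<theta>)"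
    unfolding D_def s_def k_def by (rule DERIV_divide)
  from DERIV_cdivide[OF DERIV_add[OF DERIV_ident DERIV_chain2[OF DERIV_arctan this]], of c]
  have "(primitive_inverse_sin2 c has_real_derivative
      (1 + inverse (1 + ((c - 1) * (s * k) / D)\<^sup>2) * (?N / (D * D))) / c) (at \<theta>)"
    unfolding primitive_inverse_sin2_def[abs_def] D_def s_def k_def .
  moreover have "(1 + inverse (1 + ((c - 1) * (s * k) / D)\<^sup>2) * (?N / (D * D))) / c
      = 1 / (1 + (c\<^sup>2 - 1) * (sin \<theta>)\<^sup>2)"
  proof -
    have "1 + ((c - 1) * (s * k) / D)\<^sup>2 = E / D\<^sup>2"
      using Dpos DE by (simp add: power_divide field_simps)
    moreover have "?N = c - E" using num by (simp add: sk)
    moreover have "1 + (c\<^sup>2 - 1) * (sin \<theta>)\<^sup>2 = E"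
      using sk by (simp add: E_def s_def k_def algebra_simps)
    moreover have "(1 + inverse (E / D\<^sup>2) * ((c - E) / (D * D))) / c = 1 / E"
      using Dpos Epos c by (simp add: power2_eq_square field_simps)
    ultimately show ?thesis by (simp only:)
  qed
  ultimately show ?thesis by simp
qed

section \<open>One Bernoulli factor\<close>

text \<open>The squared modulus of 1 - p + p exp (i a t) is 1 - 4 p (1 - p) sin^2 (a t / 2). Apply 1
  + y \<le> exp y and take square roots, which halves the exponent.\<close>

lemma (in prob_space) cmod_char_scaled_bernoulli_le:
  assumes B: "is_bernoulli M B p"
  shows "cmod (char (distr M borel (\<lambda>\<omega>. a * B \<omega>)) t)
    \<le> exp (- (2 * p * (1 - p) * (sin (a * t / 2))\<^sup>2))"
proof -
  define \<theta> where "\<theta> = t * a"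
  have [measurable]: "B \<in> borel_measurable M"
    and AE: "AE \<omega> in M. B \<omega> \<in> {0, 1}"
    and P: "prob {\<omega> \<in> space M. B \<omega> = 1} = p"
    using B by (auto simp: is_bernoulli_def)
  have "char (distr M borel (\<lambda>\<omega>. a * B \<omega>)) t = (CLINT \<omega>|M. iexp (t * (a * B \<omega>)))"
    by (simp add: char_def integral_distr)
  \<comment> \<open>Almost surely \<open>B\<close> is 0 or 1, so the exponential is affine in the
    indicator of \<open>B\<close> = 1.\<close>
  also have "\<dots> = (CLINT \<omega>|M. 1 + (iexp \<theta> - 1) * of_real (indicator {\<omega> \<in> space M. B \<omega> = 1} \<omega>))"
  proof (rule integral_cong_AE)
    show "AE \<omega> in M. iexp (t * (a * B \<omega>)) =
        1 + (iexp \<theta> - 1) * of_real (indicator {\<omega> \<in> space M. B \<omega> = 1} \<omega>)"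
      using AE AE_space by eventually_elim (auto simp: \<theta>_def)
  qed measurable
  also have "\<dots> = 1 + (iexp \<theta> - 1) * of_real p"
  proof -
    have "integrable M (\<lambda>\<omega>. complex_of_real (indicator {\<omega> \<in> space M. B \<omega> = 1} \<omega>))"
      by (rule integrable_const_bound[where B = 1]) (auto split: split_indicator)
    then have "integrable M (\<lambda>\<omega>. (iexp \<theta> - 1) * complex_of_real (indicator {\<omega> \<in> space M. B \<omega> = 1} \<omega>))"
      by (rule integrable_mult_right)
    then show ?thesis
      using P by (subst Bochner_Integration.integral_add) (simp_all add: prob_space)
  qed
  finally have char: "char (distr M borel (\<lambda>\<omega>. a * B \<omega>)) t = 1 + (iexp \<theta> - 1) * of_real p" .
  have "(cmod (char (distr M borel (\<lambda>\<omega>. a * B \<omega>)) t))\<^sup>2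
      = (1 - p + p * cos \<theta>)\<^sup>2 + (p * sin \<theta>)\<^sup>2"
    unfolding char cmod_power2 by (simp add: Re_exp Im_exp algebra_simps)
  also have "\<dots> = (1 - p)\<^sup>2 + 2 * p * (1 - p) * cos \<theta> + p\<^sup>2 * ((sin \<theta>)\<^sup>2 + (cos \<theta>)\<^sup>2)"
    by algebra
  also have "\<dots> = 1 - 4 * p * (1 - p) * (sin (a * t / 2))\<^sup>2"
  proof -
    have "cos \<theta> = 1 - 2 * (sin (a * t / 2))\<^sup>2"
      using cos_double_sin[of "a * t / 2"] by (simp add: \<theta>_def mult.commute)
    moreover have "(sin \<theta>)\<^sup>2 + (cos \<theta>)\<^sup>2 = 1" by simp
    ultimately show ?thesis by (simp only: power2_eq_square) (simp add: algebra_simps)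
  qed
  also have "\<dots> \<le> exp (- (4 * p * (1 - p) * (sin (a * t / 2))\<^sup>2))"
    using exp_ge_add_one_self[of "- (4 * p * (1 - p) * (sin (a * t / 2))\<^sup>2)"] by simp
  also have "\<dots> = (exp (- (2 * p * (1 - p) * (sin (a * t / 2))\<^sup>2)))\<^sup>2"
    by (simp add: exp_double[symmetric])
  finally show ?thesis
    by (rule power2_le_imp_le) simp
qed

section \<open>Convexity and averaging over the frequencies\<close>

theorem corollary5p5:
  fixes M :: "'a measure" and n :: nat and v :: "nat \<Rightarrow> real"
    and B :: "nat \<Rightarrow> 'a \<Rightarrow> real" and p :: real
  assumes "prob_space M"
    and "n \<ge> 1"
    and "\<And>i. i \<in> {1..n} \<Longrightarrow> v i \<noteq> 0"
    and "0 \<le> p" and "p \<le> 1"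
    and "\<And>i. i \<in> {1..n} \<Longrightarrow> is_bernoulli M (B i) p"
    and "prob_space.indep_vars M (\<lambda>_. borel) B {1..n}"
  shows "Q0 M (\<lambda>\<omega>. \<Sum>i = 1..n. v i * B i \<omega>) \<le> 1 / sqrt (1 + 2 * real n * p * (1 - p))"
proof -
  interpret prob_space M by fact
  define S where "S \<omega> = (\<Sum>i = 1..n. v i * B i \<omega>)" for \<omega>
  \<comment> \<open>Chosen so that \<open>c\<^sup>2 - 1\<close> is the coefficient of sin^2 below
    and the mean \<open>1 / c\<close> is the claimed bound.\<close>
  define c where "c = sqrt (1 + 2 * real n * p * (1 - p))"
  define s where "s i t = (sin (v i * t / 2))\<^sup>2" for i t
  define g where "g t = (\<Sum>i = 1..n. 1 / (1 + (c\<^sup>2 - 1) * s i t)) / n" for t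
  \<comment> \<open>The factor \<open>2 / v i\<close> undoes the chain rule for the argument
    \<open>v i * t / 2\<close>; it works for either sign of \<open>v i\<close>.\<close>
  define G where "G t = (\<Sum>i = 1..n. 2 / v i * primitive_inverse_sin2 c (v i * t / 2)) / n" for t
  have n: "real n > 0" using \<open>n \<ge> 1\<close> by simp
  have c2: "c\<^sup>2 - 1 = 2 * real n * p * (1 - p)" and c: "c \<ge> 1"
    using \<open>0 \<le> p\<close> \<open>p \<le> 1\<close> by (auto simp: c_def)
  then have pos: "1 + (c\<^sup>2 - 1) * s i t > 0" for i t
    using \<open>0 \<le> p\<close> \<open>p \<le> 1\<close> by (simp add: s_def add_pos_nonneg)
  have [measurable]: "B i \<in> borel_measurable M" if "i \<in> {1..n}" for i
    using assms(6)[OF that] by (simp add: is_bernoulli_def)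
  have S[measurable]: "S \<in> borel_measurable M"
    unfolding S_def by measurable
  have indep: "indep_vars (\<lambda>_. borel) (\<lambda>i \<omega>. v i * B i \<omega>) {1..n}"
    by (rule indep_vars_compose2[OF assms(7)]) measurable
  have char_le: "cmod (char (distr M borel S) t) \<le> g t" for t
  proof -
    have "cmod (char (distr M borel S) t)
        = (\<Prod>i = 1..n. cmod (char (distr M borel (\<lambda>\<omega>. v i * B i \<omega>)) t))"
      unfolding S_def[abs_def] char_distr_sum[OF indep] by (simp add: prod_norm)
    also have "\<dots> \<le> (\<Prod>i = 1..n. exp (- (2 * p * (1 - p) * s i t)))"
      unfolding s_def
      by (intro prod_mono conjI cmod_char_scaled_bernoulli_le assms(6)) auto
    \<comment> \<open>Since 2 p (1 - p) = (\<open>c\<^sup>2 - 1\<close>) / n, the exponent is an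
      average with weights 1/n, ready for Jensen's inequality. Afterwards each summand has a single
      frequency, so arithmetic relations among the \<open>v i\<close> do not matter.\<close>
    also have "\<dots> = exp (\<Sum>i = 1..n. (1 / n) *\<^sub>R (- ((c\<^sup>2 - 1) * s i t)))"
      using n by (simp add: exp_sum[symmetric] c2 mult.assoc)
    also have "\<dots> \<le> (\<Sum>i = 1..n. (1 / n) * exp (- ((c\<^sup>2 - 1) * s i t)))"
      using n by (intro convex_on_sum[OF _ _ exp_convex]) auto
    also have "\<dots> \<le> (\<Sum>i = 1..n. (1 / n) * (1 / (1 + (c\<^sup>2 - 1) * s i t)))"
    proof (intro sum_mono mult_left_mono)
      fix i
      show "exp (- ((c\<^sup>2 - 1) * s i t)) \<le> 1 / (1 + (c\<^sup>2 - 1) * s i t)"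
        unfolding exp_minus inverse_eq_divide
        using pos exp_ge_add_one_self by (intro divide_left_mono) auto
    qed simp
    also have "\<dots> = g t"
      by (simp add: g_def sum_divide_distrib mult.commute)
    finally show ?thesis .
  qed
  have G: "(G has_real_derivative g t) (at t)" for t
  proof -
    have "((\<lambda>t. 2 / v i * primitive_inverse_sin2 c (v i * t / 2)) has_real_derivative
        1 / (1 + (c\<^sup>2 - 1) * s i t)) (at t)" if "i \<in> {1..n}" for i
    proof -
      have "((\<lambda>t. primitive_inverse_sin2 c (v i * t / 2)) has_real_derivative
          1 / (1 + (c\<^sup>2 - 1) * s i t) * (v i / 2)) (at t)"
        unfolding s_def
        by (rule DERIV_chain2[OF has_real_derivative_primitive_inverse_sin2])
          (use c in \<open>auto intro!: derivative_eq_intros\<close>)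
      then have "((\<lambda>t. 2 / v i * primitive_inverse_sin2 c (v i * t / 2)) has_real_derivative
          2 / v i * (1 / (1 + (c\<^sup>2 - 1) * s i t) * (v i / 2))) (at t)"
        by (rule DERIV_cmult)
      moreover have "2 / v i * (a * (v i / 2)) = a" for a
        using assms(3)[OF that] by simp
      ultimately show ?thesis by (simp only:)
    qed
    then show ?thesis
      unfolding G_def[abs_def] g_def by (intro DERIV_cdivide DERIV_sum)
  qed
  have g: "isCont g t" for t
    unfolding g_def[abs_def]
  proof (intro continuous_intros)
    show "isCont (s i) t" for i
      unfolding s_def[abs_def] by (intro continuous_intros) auto
    show "1 + (c\<^sup>2 - 1) * s i t \<noteq> 0" for i
      using pos[of i t] by simp
    show "real n \<noteq> 0" using n by simp
  qed
  \<comment> \<open>In the linear term \<open>2 / v i\<close> cancels the frequency and leaves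
    \<open>T / c\<close> for every \<open>i\<close>. The error depends on the \<open>v i\<close> but
    not on \<open>T\<close>.\<close>
  have G_le: "G T - G 0 \<le> 1 / c * T + (\<Sum>i = 1..n. \<bar>2 / v i\<bar> * (pi / (2 * c))) / n" for T
  proof -
    have "2 / v i * primitive_inverse_sin2 c (v i * T / 2) \<le> T / c + \<bar>2 / v i\<bar> * (pi / (2 * c))"
      if "i \<in> {1..n}" for i
    proof -
      have "2 / v i * primitive_inverse_sin2 c (v i * T / 2) - T / c
          = 2 / v i * (primitive_inverse_sin2 c (v i * T / 2) - v i * T / 2 / c)"
        using assms(3)[OF that] c by (simp add: field_simps)
      also have "\<dots> \<le> \<bar>2 / v i\<bar> * (pi / (2 * c))"
      proof (rule order_trans[OF abs_ge_self])
        have "\<bar>primitive_inverse_sin2 c (v i * T / 2) - v i * T / 2 / c\<bar> \<le> pi / (2 * c)"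
          using c by (intro primitive_inverse_sin2_bound) simp
        then show "\<bar>2 / v i * (primitive_inverse_sin2 c (v i * T / 2) - v i * T / 2 / c)\<bar>
            \<le> \<bar>2 / v i\<bar> * (pi / (2 * c))"
          unfolding abs_mult by (rule mult_left_mono) simp
      qed
      finally show ?thesis by linarith
    qed
    then have "(\<Sum>i = 1..n. 2 / v i * primitive_inverse_sin2 c (v i * T / 2))
        \<le> (\<Sum>i = 1..n. T / c + \<bar>2 / v i\<bar> * (pi / (2 * c)))"
      by (rule sum_mono)
    also have "\<dots> = n * (T / c) + (\<Sum>i = 1..n. \<bar>2 / v i\<bar> * (pi / (2 * c)))"
      by (simp add: sum.distrib)
    finally have "G T \<le> (n * (T / c) + (\<Sum>i = 1..n. \<bar>2 / v i\<bar> * (pi / (2 * c)))) / n"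
      unfolding G_def using n by (intro divide_right_mono) auto
    then show ?thesis using n by (simp add: add_divide_distrib G_def)
  qed
  have "prob {\<omega> \<in> space M. S \<omega> = x} \<le> 1 / c" for x
    by (rule prob_eq_le_char_mean[OF S G g char_le G_le])
  then have "Q0 M S \<le> 1 / c"
    unfolding Q0_def by (intro cSUP_least) auto
  then show ?thesis by (simp add: S_def[abs_def] c_def)
qed

end
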